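(* Suppose that for each integer $k\ge1$ there are numbers $b_{k,1},\dots,b_{k,k}$ such that for every $n\ge\max\{3,2k\}$ with $CP_n([n-k+1,n])\ne\emptyset$, $$cp_n([n-k+1,n]) = k(k+1)\sum_{i=1}^k (-1)^{i+1} b_{k,i}\left[(2k+2)^{n-2k}-(2k+2-2i)^{n-2k}\right].$$ Then for all $k\ge1$ the coefficients satisfy $$b_{k+1,i}=\begin{cases} k(k+1)^2\sum_{j=1}^k(-1)^{j+1}b_{k,j} & \text{if } i=1,\\ k(k+1)\frac{k+2-i}{i}\,b_{k,i-1} & \text{if } 2\le i\le k+1.\end{cases}$$
   Context: For integers $a \le b$, $[a,b]=\{a,a+1,\dots,b\}$, $[a,b]=\emptyset$ if $a>b$, and $[n]=[1,n]$. $\mathfrak{S}_n$ is the set of permutations of $[n]$, written in one-line form $\sigma=(\sigma(1)\cdots\sigma(n))$. The circular peak set of $\sigma\in\mathfrak{S}_n$ is $CP(\sigma)=\{\sigma(i) : 2\le i\le n-1,\ \sigma(i-1)<\sigma(i)>\sigma(i+1)\}$. For $S\subseteq[n]$, $CP_n(S)=\{\sigma\in\mathfrak{S}_n : CP(\sigma)=S\}$ and $cp_n(S)=|CP_n(S)|$. *)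

theory Defs
  imports Complex_Main "HOL-Combinatorics.Permutations"
begin

(* The set contains the values of the peaks, not their positions. *)
definition circ_peak_set :: "nat \<Rightarrow> (nat \<Rightarrow> nat) \<Rightarrow> nat set" where
  "circ_peak_set n \<sigma> =
     {\<sigma> i |i. 2 \<le> i \<and> i \<le> n - 1 \<and> \<sigma> (i - 1) < \<sigma> i \<and> \<sigma> i > \<sigma> (i + 1)}"

definition CP :: "nat \<Rightarrow> nat set \<Rightarrow> (nat \<Rightarrow> nat) set" where
  "CP n S = {\<sigma>. \<sigma> permutes {1..n} \<and> circ_peak_set n \<sigma> = S}"

definition cp :: "nat \<Rightarrow> nat set \<Rightarrow> nat" where
  "cp n S = card (CP n S)"

end

theory Submission
  imports Defs "HOL-Combinatorics.Multiset_Permutations"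
begin

text \<open>
  A permutation of $[n]$ whose peaks are exactly the $k$ largest values is a word
  $V_0\, p_1\, V_1 \cdots p_k\, V_k$, where the $p_i$ are the peaks in any order and the $n - k$ other
  values are distributed over $k + 1$ nonempty peak-free blocks $V_i$. A set of $c \ge 1$ values
  has $2^{c-1}$ peak-free arrangements, so splitting off the block before the first peak gives, by
  induction on $k$,
  \[ cp_n([n-k+1,n]) = \frac{k!}{2^{k+1}} \sum_{i=0}^{k} (-1)^i {k+1 \choose i} (2k+2-2i)^{n-k}. \]
  The powers $m \mapsto (2k+2-2i)^m$ with $0 \le i \le k$ are linearly independent, so this
  determines the coefficients: $b_{k,i} = \frac{k!}{2k(k+1)} {k+1 \choose i} (k+1-i)^k$, and the
  coefficient of $(2k+2)^m$ gives the alternating sum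
  $k(k+1) \sum_j (-1)^{j+1} b_{k,j} = k!\,(k+1)^k / 2$. The recursion is read off from these.
\<close>

section \<open>Peaks of a word\<close>

text \<open>Peaks are recorded as values, as in \<open>circ_peak_set\<close>; the triple starts at
  \<open>i\<close>, so that no truncated subtraction occurs.\<close>

definition peaks :: "'a::linorder list \<Rightarrow> 'a set" where
  "peaks xs = {xs ! Suc i |i. Suc (Suc i) < length xs \<and> xs ! i < xs ! Suc i \<and> xs ! Suc (Suc i) < xs ! Suc i}"

lemma peaks_iff:
  "y \<in> peaks xs \<longleftrightarrow> (\<exists>us x z vs. xs = us @ x # y # z # vs \<and> x < y \<and> z < y)"
proof
  assume "y \<in> peaks xs"
  then obtain i where i: "Suc (Suc i) < length xs" "xs ! i < xs ! Suc i" "xs ! Suc (Suc i) < xs ! Suc i" "y = xs ! Suc i"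
    by (auto simp: peaks_def)
  then have "xs = take i xs @ xs ! i # xs ! Suc i # xs ! Suc (Suc i) # drop (Suc (Suc (Suc i))) xs"
    by (simp add: Cons_nth_drop_Suc)
  with i show "\<exists>us x z vs. xs = us @ x # y # z # vs \<and> x < y \<and> z < y" by blast
next
  assume "\<exists>us x z vs. xs = us @ x # y # z # vs \<and> x < y \<and> z < y"
  then obtain us x z vs where "xs = us @ x # y # z # vs" "x < y" "z < y" by blast
  then show "y \<in> peaks xs"
    unfolding peaks_def by (auto intro!: exI[of _ "length us"] simp: nth_append)
qed

lemma peaks_Nil [simp]: "peaks [] = {}" and peaks_single [simp]: "peaks [x] = {}"
  by (auto simp: peaks_def)

lemma peaks_subset: "peaks xs \<subseteq> set xs"
  by (auto simp: peaks_iff)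

lemma peaks_Cons_Cons:
  "peaks (x # y # zs) = (if x < y \<and> zs \<noteq> [] \<and> hd zs < y then insert y (peaks (y # zs)) else peaks (y # zs))"
proof -
  have "p \<in> peaks (x # y # zs) \<longleftrightarrow> (x < y \<and> zs \<noteq> [] \<and> hd zs < y \<and> p = y) \<or> p \<in> peaks (y # zs)" for p
    unfolding peaks_iff by (cases zs) (auto simp: Cons_eq_append_conv, metis+)
  then show ?thesis by auto
qed

lemma peaks_Cons: "zs = [] \<or> hd zs < x \<Longrightarrow> peaks (x # zs) = peaks zs"
  by (cases zs) (auto simp: peaks_Cons_Cons)

text \<open>The letters beside \<open>p\<close> come from the ends of \<open>xs\<close> and
  \<open>ys\<close>, where they are in the middle of no triple; next to the larger \<open>p\<close>
  they are still no peaks. All triples inside \<open>xs\<close> and \<open>ys\<close> survive, so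
  only the position of \<open>p\<close> can contribute something new.\<close>

lemma peaks_append:
  assumes "xs \<noteq> []" "last xs < p" "ys \<noteq> [] \<Longrightarrow> hd ys < p"
  shows "peaks (xs @ p # ys) = (if ys = [] then {} else {p}) \<union> peaks xs \<union> peaks ys"
  using assms
proof (induction xs)
  case (Cons x xs)
  show ?case
  proof (cases xs)
    case Nil
    with Cons.prems show ?thesis by (auto simp: peaks_Cons_Cons peaks_Cons)
  next
    case (Cons x' xs')
    with Cons.IH Cons.prems show ?thesis
      by (cases xs') (auto simp: peaks_Cons_Cons)
  qed
qed simp

lemma peaks_snoc: "xs = [] \<or> last xs < x \<Longrightarrow> peaks (xs @ [x]) = peaks xs"
  using peaks_append[of xs x "[]"] by (cases "xs = []") auto

text \<open>By distinctness \<open>p\<close> occurs only once, so the triple that witnesses the peak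
  sits exactly at the given split.\<close>

lemma peaks_neighbours:
  assumes "distinct (xs @ p # ys)" "p \<in> peaks (xs @ p # ys)"
  shows "xs \<noteq> []" "last xs < p" "ys \<noteq> []" "hd ys < p"
proof -
  obtain us x z vs where *: "xs @ p # ys = us @ x # p # z # vs" "x < p" "z < p"
    using assms(2) by (auto simp: peaks_iff)
  then have "xs @ p # ys = (us @ [x]) @ p # (z # vs)" by simp
  then have "xs = us @ [x]" "ys = z # vs"
    using assms(1) by (metis append_Cons_eq_iff distinct_append not_distinct_conv_prefix distinct.simps(2))+
  with * show "xs \<noteq> []" "last xs < p" "ys \<noteq> []" "hd ys < p" by auto
qed

text \<open>
  Excluding the empty word makes the count in \<open>card_peak_words\<close> also correct for \<open>A = {}\<close>, and
  forces the blocks between consecutive peaks to be nonempty.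
\<close>
definition peak_words :: "'a::linorder set \<Rightarrow> 'a set \<Rightarrow> 'a list set" where
  "peak_words A B = {xs. xs \<noteq> [] \<and> distinct xs \<and> set xs = A \<union> B \<and> peaks xs = B}"

lemma finite_peak_words: "finite A \<Longrightarrow> finite B \<Longrightarrow> finite (peak_words A B)"
  by (rule finite_subset[of _ "{xs. set xs = A \<union> B \<and> distinct xs}"])
    (auto simp: peak_words_def intro: finite_subset[OF _ finite_subset_distinct[of "A \<union> B"]])

section \<open>Peak-free words\<close>

text \<open>The maximum of a peak-free word stands at one of its two ends, since inside it would be
  a peak; so each new maximum doubles the count. The term \<open>0 ^ card A\<close> corrects the
  value at \<open>A = {}\<close>, where there is no word.\<close>

lemma card_peak_free_words:
  "finite A \<Longrightarrow> card (peak_words A {}) = (2 ^ card A - 0 ^ card A) div 2"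
proof (induction rule: finite_linorder_max_induct)
  case empty
  then show ?case by (simp add: peak_words_def)
next
  case (insert m A)
  show ?case
  proof (cases "A = {}")
    case True
    \<comment> \<open>The doubling cannot start from \<open>A = {}\<close>, which has no words, so
      one letter is counted directly.\<close>
    have "peak_words {m} {} = {[m]}"
    proof -
      have "xs = [m]" if "xs \<noteq> []" "distinct xs" "set xs = {m}" for xs
        using that by (cases xs; cases "tl xs") auto
      then show ?thesis by (auto simp: peak_words_def)
    qed
    with True show ?thesis by simp
  next
    case False
    let ?W = "peak_words A {}"
    have less: "xs \<noteq> []" "hd xs < m" "last xs < m" if "set xs = A" for xs
      using that False insert.hyps by (metis hd_in_set last_in_set set_empty)+
    have eq: "peak_words (insert m A) {} = (#) m ` ?W \<union> (\<lambda>xs. xs @ [m]) ` ?W"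
    proof (intro set_eqI iffI)
      fix xs assume xs: "xs \<in> peak_words (insert m A) {}"
      then obtain us vs where e: "xs = us @ m # vs"
        by (auto simp: peak_words_def) (metis insertI1 split_list)
      have d: "distinct (us @ m # vs)" "set us \<union> set vs = A" "peaks (us @ m # vs) = {}"
        using xs e insert.hyps by (auto simp: peak_words_def)
      have lt: "\<forall>a\<in>set us \<union> set vs. a < m" using d insert.hyps by auto
      have "us = [] \<or> vs = []"
      proof (rule ccontr)
        assume "\<not> ?thesis"
        with lt have "m \<in> peaks (us @ m # vs)"
          by (subst peaks_append) auto
        with d show False by simp
      qed
      then show "xs \<in> (#) m ` ?W \<union> (\<lambda>xs. xs @ [m]) ` ?W"
      proof
        assume "us = []"
        with d lt less[of vs] e have "vs \<in> ?W" by (simp add: peak_words_def peaks_Cons)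
        with e \<open>us = []\<close> show ?thesis by auto
      next
        assume "vs = []"
        with d lt less[of us] have "us \<in> ?W" by (simp add: peak_words_def peaks_snoc)
        with e \<open>vs = []\<close> show ?thesis by auto
      qed
    next
      fix xs assume "xs \<in> (#) m ` ?W \<union> (\<lambda>xs. xs @ [m]) ` ?W"
      then show "xs \<in> peak_words (insert m A) {}"
        using less insert.hyps by (auto simp: peak_words_def peaks_Cons peaks_snoc)
    qed
    \<comment> \<open>In a common word \<open>m # xs = ys @ [m]\<close> the nonempty
      \<open>ys\<close> would begin with \<open>m\<close>, but its letters lie in
      \<open>A\<close>.\<close>
    have disj: "(#) m ` ?W \<inter> (\<lambda>xs. xs @ [m]) ` ?W = {}"
      using insert.hyps by (auto simp: peak_words_def Cons_eq_append_conv)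
    have "card (peak_words (insert m A) {}) = 2 * card ?W"
      unfolding eq using disj insert.hyps
      by (subst card_Un_disjoint) (auto simp: finite_peak_words card_image inj_on_def)
    moreover have "m \<notin> A" using insert.hyps by auto
    moreover obtain c where "card A = Suc c"
      using False insert.hyps by (metis card_eq_0_iff not0_implies_Suc)
    ultimately show ?thesis using insert by simp
  qed
qed

lemma card_peak_free_words_real:
  assumes "finite A"
  shows "real (card (peak_words A {})) = (2 ^ card A - 0 ^ card A) / 2"
  unfolding card_peak_free_words[OF assms] by (cases "card A") auto


section \<open>Splitting at the first peak\<close>

text \<open>Each word is cut at its first letter \<open>p\<close> from \<open>B\<close>. What
  precedes is a peak-free word on some \<open>C\<close> inside \<open>A\<close>; what follows has
  the remaining peaks and the remaining small letters. \<open>peaks_append\<close> relates the peaks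
  of the pieces to those of the whole.\<close>

lemma bij_betw_peak_words:
  fixes A B :: "'a::linorder set"
  assumes less: "\<And>a b. a \<in> A \<Longrightarrow> b \<in> B \<Longrightarrow> a < b" and "B \<noteq> {}"
  shows "bij_betw (\<lambda>(p, C, us, vs). us @ p # vs)
           (SIGMA p:B. SIGMA C:Pow A. peak_words C {} \<times> peak_words (A - C) (B - {p}))
           (peak_words A B)" (is "bij_betw ?f ?S _")
proof (rule bij_betw_imageI)
  have disj: "A \<inter> B = {}" using less by fastforce
  show "inj_on ?f ?S"
  proof (rule inj_onI)
    fix s t assume st: "s \<in> ?S" "t \<in> ?S" "?f s = ?f t"
    obtain p C us vs p' C' us' vs' where s: "s = (p, C, us, vs)" and t: "t = (p', C', us', vs')"
      by (metis surj_pair)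
    have *: "p \<in> B" "p' \<in> B" "C \<subseteq> A" "C' \<subseteq> A" "us \<in> peak_words C {}" "us' \<in> peak_words C' {}"
      "us @ p # vs = us' @ p' # vs'"
      using st s t by auto
    \<comment> \<open>\<open>us\<close> is the longest prefix with letters in \<open>A\<close>, so
      the word alone determines the cut.\<close>
    have tw: "takeWhile (\<lambda>x. x \<in> A) (ws @ q # zs) = ws" if "set ws \<subseteq> A" "q \<in> B" for ws q zs
      using that disj by (auto simp: takeWhile_append)
    have "us = us'"
      using * tw[of us p vs] tw[of us' p' vs'] by (simp add: peak_words_def)
    with * s t show "s = t"
      by (auto simp: peak_words_def)
  qed
  show "?f ` ?S = peak_words A B"
  proof (intro set_eqI iffI)
    fix xs assume "xs \<in> ?f ` ?S"
    then obtain p C us vs where *: "xs = us @ p # vs" "p \<in> B" "C \<subseteq> A"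
      "us \<in> peak_words C {}" "vs \<in> peak_words (A - C) (B - {p})"
      by auto
    have u: "us \<noteq> []" "distinct us" "set us = C" "peaks us = {}"
      using * by (auto simp: peak_words_def)
    have v: "vs \<noteq> []" "distinct vs" "set vs = (A - C) \<union> (B - {p})" "peaks vs = B - {p}"
      using * by (auto simp: peak_words_def)
    have "last us < p"
      using u * less by (metis last_in_set subsetD)
    \<comment> \<open>A first letter has no left neighbour and so is no peak. As the peaks of
      \<open>vs\<close> are \<open>B - {p}\<close>, this letter lies in \<open>A\<close>, hence
      below \<open>p\<close>.\<close>
    have hd: "hd vs \<notin> peaks vs"
    proof
      assume a: "hd vs \<in> peaks vs"
      obtain z zs where "vs = z # zs" using v(1) by (cases vs) auto
      with a v(2) peaks_neighbours(1)[of "[]" z zs] show False by simp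
    qed
    have "hd vs < p"
      using v hd * less by (metis Diff_iff Un_iff hd_in_set)
    have "peaks xs = B"
      unfolding *(1) peaks_append[OF u(1) \<open>last us < p\<close> \<open>hd vs < p\<close>] using u(4) v(1,4) *(2) by auto
    then show "xs \<in> peak_words A B"
      using u(1-3) v(1-3) *(1-3) disj by (auto simp: peak_words_def)
  next
    fix xs assume xs: "xs \<in> peak_words A B"
    then have ex: "\<exists>x\<in>set xs. x \<in> B" using \<open>B \<noteq> {}\<close> by (auto simp: peak_words_def)
    then obtain us p vs where e: "xs = us @ p # vs" "p \<in> B" "\<forall>u\<in>set us. u \<notin> B"
      using split_list_first_prop[OF ex] by blast
    have d: "distinct (us @ p # vs)" "peaks (us @ p # vs) = B" "set (us @ p # vs) = A \<union> B"
      using xs e by (auto simp: peak_words_def)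
    note n = peaks_neighbours[OF d(1), unfolded d(2), OF e(2)]
    have B: "B = insert p (peaks us \<union> peaks vs)"
      using peaks_append[OF n(1,2,4)] n(3) d(2) by auto
    have "peaks us = {}" using B e(3) peaks_subset[of us] by auto
    moreover have "peaks vs = B - {p}"
      using B \<open>peaks us = {}\<close> d(1) peaks_subset[of vs] by auto
    moreover have "set us \<subseteq> A" using d(3) e(3) by auto
    moreover have "set vs = (A - set us) \<union> (B - {p})"
      using d e \<open>set us \<subseteq> A\<close> disj by auto
    ultimately have "(p, set us, us, vs) \<in> ?S"
      using d(1) n e(2) by (auto simp: peak_words_def)
    then show "xs \<in> ?f ` ?S" using e(1) by (intro rev_image_eqI) auto
  qed
qed

text \<open>A one-letter block followed by a peak can be put in front of a shorter word; removing
  one element from each of \<open>A\<close> and \<open>B\<close> preserves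
  \<open>card B < card A\<close>.\<close>

lemma peak_words_nonempty:
  fixes A B :: "'a::linorder set"
  assumes "finite B" "finite A" "\<And>a b. a \<in> A \<Longrightarrow> b \<in> B \<Longrightarrow> a < b" "card B < card A"
  shows "peak_words A B \<noteq> {}"
  using assms
proof (induction "card B" arbitrary: A B)
  case 0
  then obtain c where "card A = Suc c" by (metis not0_implies_Suc not_less0)
  with 0 have "card (peak_words A B) \<noteq> 0"
    using card_peak_free_words[of A] by simp
  then show ?case by force
next
  case (Suc k)
  obtain p where p: "p \<in> B" using Suc.hyps(2) by fastforce
  obtain a where a: "a \<in> A" using Suc.prems(4) by fastforce
  have "peak_words (A - {a}) (B - {p}) \<noteq> {}"
    using Suc.prems Suc.hyps(2) p a by (intro Suc.hyps(1)) auto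
  then obtain vs where "vs \<in> peak_words (A - {a}) (B - {p})" by blast
  moreover have "[a] \<in> peak_words {a} {}" by (simp add: peak_words_def)
  ultimately have "[a] @ p # vs \<in> peak_words A B"
    using p a bij_betw_apply[OF bij_betw_peak_words[of A B], of "(p, {a}, [a], vs)"] Suc.prems(3)
    by auto
  then show ?case by blast
qed

section \<open>The closed formula for the number of words\<close>

lemma sum_Pow_power:
  fixes x y :: "'a::comm_ring_1"
  assumes "finite A"
  shows "(\<Sum>C\<in>Pow A. x ^ card C * y ^ card (A - C)) = (x + y) ^ card A"
  using prod_add[OF assms, of "\<lambda>_. x" "\<lambda>_. y"] by simp

text \<open>Pascal's rule together with an index shift. It absorbs the differences produced by
  splitting off a block and so carries the closed formula from \<open>k\<close> to
  \<open>Suc k\<close>.\<close>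

lemma alternating_binomial_sum_Suc:
  fixes f :: "nat \<Rightarrow> 'a::comm_ring_1"
  shows "(\<Sum>i\<le>Suc k. (-1) ^ i * of_nat (Suc k choose i) * f i)
       = (\<Sum>i\<le>k. (-1) ^ i * of_nat (k choose i) * (f i - f (Suc i)))"
proof -
  have "(\<Sum>i\<le>k. (-1) ^ i * of_nat (k choose i) * f i)
      = (\<Sum>i\<le>Suc k. (-1) ^ i * of_nat (k choose i) * f i)" by (simp add: binomial_eq_0)
  also have "\<dots> = f 0 - (\<Sum>i\<le>k. (-1) ^ i * of_nat (k choose Suc i) * f (Suc i))"
    by (simp add: sum.atMost_Suc_shift sum_negf del: sum.atMost_Suc)
  finally show ?thesis
    by (simp add: sum.atMost_Suc_shift algebra_simps sum.distrib sum_negf sum_subtractf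
        del: sum.atMost_Suc)
qed

text \<open>Summing over the set \<open>C\<close> of the first block convolves
  \<open>(2 ^ c - 0 ^ c) / 2\<close> with powers of \<open>t\<close>, which gives half of
  \<open>(2 + t) ^ a - t ^ a\<close> with \<open>a = card A\<close>.\<close>

lemma card_peak_words:
  fixes A B :: "'a::linorder set"
  assumes "finite A" "finite B" "\<And>a b. a \<in> A \<Longrightarrow> b \<in> B \<Longrightarrow> a < b" "card B = k"
  shows "real (card (peak_words A B)) = fact k / 2 ^ Suc k *
           (\<Sum>i\<le>Suc k. (-1) ^ i * real (Suc k choose i) * (2 * real (Suc k - i)) ^ card A)"
  using assms
proof (induction k arbitrary: A B)
  case 0
  then show ?case by (simp add: card_peak_free_words_real)
next
  case (Suc k)
  let ?H = "\<lambda>a. \<Sum>i\<le>Suc k. (-1) ^ i * real (Suc k choose i) * (2 * real (Suc k - i)) ^ a"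
  have "B \<noteq> {}" using Suc.prems by auto
  have fin: "finite C" if "C \<subseteq> A" for C using finite_subset[OF that Suc.prems(1)] .
  have "card (peak_words A B) =
      card (SIGMA p:B. SIGMA C:Pow A. peak_words C {} \<times> peak_words (A - C) (B - {p}))"
    using bij_betw_same_card[OF bij_betw_peak_words[of A B]] Suc.prems(3) \<open>B \<noteq> {}\<close> by simp
  also have "\<dots> = (\<Sum>p\<in>B. \<Sum>C\<in>Pow A. card (peak_words C {}) * card (peak_words (A - C) (B - {p})))"
  proof -
    have *: "finite (peak_words C {})" "finite (peak_words (A - C) (B - {p}))" if "C \<in> Pow A" for C p
      using that Suc.prems fin by (auto intro!: finite_peak_words)
    have "finite (SIGMA C:Pow A. peak_words C {} \<times> peak_words (A - C) (B - {p}))" for p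
      by (rule finite_SigmaI) (use Suc.prems(1) * in \<open>auto simp del: Pow_iff\<close>)
    then have "card (SIGMA p:B. SIGMA C:Pow A. peak_words C {} \<times> peak_words (A - C) (B - {p})) =
        (\<Sum>p\<in>B. card (SIGMA C:Pow A. peak_words C {} \<times> peak_words (A - C) (B - {p})))"
      using Suc.prems(2) by (intro card_SigmaI) auto
    also have "\<dots> = (\<Sum>p\<in>B. \<Sum>C\<in>Pow A. card (peak_words C {} \<times> peak_words (A - C) (B - {p})))"
      using Suc.prems(1) * by (intro sum.cong refl card_SigmaI) (auto simp del: Pow_iff)
    finally show ?thesis by (simp only: card_cartesian_product)
  qed
  also have "real \<dots> = (\<Sum>p\<in>B. \<Sum>C\<in>Pow A.
      (2 ^ card C - 0 ^ card C) / 2 * (fact k / 2 ^ Suc k * ?H (card (A - C))))"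
    unfolding of_nat_sum of_nat_mult
  proof (intro sum.cong refl arg_cong2[of _ _ _ _ "(*)"])
    fix p C assume "p \<in> B" "C \<in> Pow A"
    then show "real (card (peak_words C {})) = (2 ^ card C - 0 ^ card C) / 2"
      by (intro card_peak_free_words_real fin) auto
    show "real (card (peak_words (A - C) (B - {p}))) = fact k / 2 ^ Suc k * ?H (card (A - C))"
      using Suc.prems \<open>p \<in> B\<close> by (intro Suc.IH) auto
  qed
  \<comment> \<open>The summand does not depend on \<open>p\<close>: the choice of the first peak
    gives the factor \<open>Suc k\<close>, and the first block gives one more factor 1/2.\<close>
  also have "\<dots> = fact (Suc k) / 2 ^ Suc (Suc k) *
      (\<Sum>C\<in>Pow A. (2 ^ card C - 0 ^ card C) * ?H (card (A - C)))"
    using Suc.prems by (simp add: sum_distrib_left sum_divide_distrib mult_ac del: sum.atMost_Suc)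
  also have "(\<Sum>C\<in>Pow A. (2 ^ card C - 0 ^ card C) * ?H (card (A - C)))
      = (\<Sum>i\<le>Suc k. (-1) ^ i * real (Suc k choose i) *
          (\<Sum>C\<in>Pow A. (2 ^ card C - 0 ^ card C) * (2 * real (Suc k - i)) ^ card (A - C)))"
    unfolding sum_distrib_left by (subst sum.swap) (simp only: mult_ac)
  also have "\<dots> = (\<Sum>i\<le>Suc k. (-1) ^ i * real (Suc k choose i) *
      ((2 * real (Suc (Suc k) - i)) ^ card A - (2 * real (Suc (Suc k) - Suc i)) ^ card A))"
  proof (intro sum.cong refl arg_cong2[of _ _ _ _ "(*)"])
    fix i assume "i \<in> {..Suc k}"
    \<comment> \<open>For \<open>t = 2 * real (Suc k - i)\<close>, the bases \<open>2 + t\<close>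
      and \<open>0 + t\<close> are the values of one function at \<open>i\<close> and
      \<open>Suc i\<close>.\<close>
    then have "2 + 2 * real (Suc k - i) = 2 * real (Suc (Suc k) - i)" by simp
    moreover have "(\<Sum>C\<in>Pow A. (2 ^ card C - 0 ^ card C) * t ^ card (A - C))
        = (2 + t) ^ card A - (0 + t) ^ card A" for t :: real
      unfolding left_diff_distrib sum_subtractf sum_Pow_power[OF Suc.prems(1)] ..
    ultimately show "(\<Sum>C\<in>Pow A. (2 ^ card C - 0 ^ card C) * (2 * real (Suc k - i)) ^ card (A - C))
        = (2 * real (Suc (Suc k) - i)) ^ card A - (2 * real (Suc (Suc k) - Suc i)) ^ card A"
      by (simp only: diff_Suc_Suc add_0)
  qed
  also have "\<dots> = (\<Sum>i\<le>Suc (Suc k). (-1) ^ i * real (Suc (Suc k) choose i) * (2 * real (Suc (Suc k) - i)) ^ card A)"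
    by (rule alternating_binomial_sum_Suc[symmetric])
  finally show ?case .
qed

section \<open>Permutations as words\<close>

text \<open>One-line notation is injective, and both sides have n! elements, so surjectivity follows
  by counting.\<close>

lemma bij_betw_permutes_lists:
  "bij_betw (\<lambda>\<sigma>. map \<sigma> [1..<Suc n]) {\<sigma>. \<sigma> permutes {1..n}} {xs. distinct xs \<and> set xs = {1..n}}"
proof -
  let ?f = "\<lambda>\<sigma>::nat\<Rightarrow>nat. map \<sigma> [1..<Suc n]" and ?P = "{\<sigma>. \<sigma> permutes {1..n}}"
  have inj: "inj_on ?f ?P"
  proof (rule inj_onI, rule ext)
    fix \<sigma> \<tau> :: "nat \<Rightarrow> nat" and x
    assume *: "\<sigma> \<in> ?P" "\<tau> \<in> ?P" "?f \<sigma> = ?f \<tau>"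
    then have "\<forall>x\<in>{1..n}. \<sigma> x = \<tau> x" by (auto simp del: upt_Suc)
    then show "\<sigma> x = \<tau> x" using * by (cases "x \<in> {1..n}") (auto simp: permutes_def)
  qed
  have sub: "?f ` ?P \<subseteq> permutations_of_set {1..n}"
  proof
    fix xs assume "xs \<in> ?f ` ?P"
    then obtain \<sigma> where s: "xs = ?f \<sigma>" "\<sigma> permutes {1..n}" by blast
    have "set [1..<Suc n] = {1..n}" by auto
    with s show "xs \<in> permutations_of_set {1..n}"
      using permutes_image[OF s(2)] permutes_inj_on[OF s(2), of "{1..n}"]
      by (simp add: permutations_of_set_def distinct_map del: upt_Suc)
  qed
  have "?f ` ?P = permutations_of_set {1..n}"
    using sub inj by (intro card_subset_eq) (simp_all add: card_image card_permutations del: upt_Suc)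
  with inj show ?thesis
    by (auto simp: bij_betw_def permutations_of_set_def)
qed

lemma circ_peak_set_eq_peaks: "circ_peak_set n \<sigma> = peaks (map \<sigma> [1..<Suc n])"
proof (intro set_eqI iffI)
  fix y assume "y \<in> circ_peak_set n \<sigma>"
  then obtain i where "2 \<le> i" "i \<le> n - 1" "\<sigma> (i - 1) < \<sigma> i" "\<sigma> (i + 1) < \<sigma> i" "y = \<sigma> i"
    by (auto simp: circ_peak_set_def)
  \<comment> \<open>Lists are indexed from 0: entry \<open>Suc j\<close> is
    \<open>\<sigma> (Suc (Suc j))\<close>, the middle of the triple starting at
    \<open>j\<close>.\<close>
  moreover obtain j where "i = Suc (Suc j)" using \<open>2 \<le> i\<close> by (metis add_2_eq_Suc le_Suc_ex)
  ultimately show "y \<in> peaks (map \<sigma> [1..<Suc n])"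
    unfolding peaks_def by (auto intro!: exI[of _ j] simp del: upt_Suc)
next
  fix y assume "y \<in> peaks (map \<sigma> [1..<Suc n])"
  then obtain j where "Suc (Suc j) < n" "\<sigma> (Suc j) < \<sigma> (Suc (Suc j))"
      "\<sigma> (Suc (Suc (Suc j))) < \<sigma> (Suc (Suc j))" "y = \<sigma> (Suc (Suc j))"
    by (auto simp: peaks_def simp del: upt_Suc)
  then show "y \<in> circ_peak_set n \<sigma>"
    unfolding circ_peak_set_def by (auto intro!: exI[of _ "Suc (Suc j)"])
qed

lemma bij_betw_CP_peak_words:
  assumes "k < n"
  shows "bij_betw (\<lambda>\<sigma>. map \<sigma> [1..<Suc n]) (CP n {n - k + 1..n}) (peak_words {1..n - k} {n - k + 1..n})"
proof -
  have "{1..n - k} \<union> {n - k + 1..n} = {1..n}" using assms by auto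
  moreover have "{1..n} \<noteq> {}" using assms by auto
  ultimately have "peak_words {1..n - k} {n - k + 1..n} =
      {xs \<in> {xs. distinct xs \<and> set xs = {1..n}}. peaks xs = {n - k + 1..n}}"
    by (auto simp: peak_words_def)
  moreover have "CP n {n - k + 1..n} =
      {\<sigma> \<in> {\<sigma>. \<sigma> permutes {1..n}}. peaks (map \<sigma> [1..<Suc n]) = {n - k + 1..n}}"
    by (simp add: CP_def circ_peak_set_eq_peaks)
  moreover have "bij_betw f {x \<in> X. P (f x)} {y \<in> Y. P y}" if "bij_betw f X Y"
    for f :: "(nat \<Rightarrow> nat) \<Rightarrow> nat list" and X Y P
    using that by (auto simp: bij_betw_def inj_on_def)
  ultimately show ?thesis
    using bij_betw_permutes_lists[of n] by (simp only:)
qed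

section \<open>Linear independence of powers\<close>

text \<open>Subtracting \<open>x a\<close> times the relation at \<open>m\<close> from the one at
  \<open>Suc m\<close> eliminates the node \<open>x a\<close> and multiplies every other coefficient
  by a nonzero difference of nodes.\<close>

lemma power_combination_zero:
  fixes x :: "'a \<Rightarrow> 'b::idom"
  assumes "finite I" "inj_on x I" "\<And>m. (\<Sum>i\<in>I. c i * x i ^ m) = 0" "i \<in> I"
  shows "c i = 0"
  using assms
proof (induction I arbitrary: c i rule: finite_induct)
  case (insert a I)
  have "(\<Sum>j\<in>I. c j * (x j - x a) * x j ^ m) = 0" for m
  proof -
    have "(\<Sum>j\<in>I. c j * (x j - x a) * x j ^ m) =
        (\<Sum>j\<in>insert a I. c j * x j ^ Suc m) - x a * (\<Sum>j\<in>insert a I. c j * x j ^ m)"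
      using insert.hyps by (simp add: algebra_simps sum_subtractf sum_distrib_left)
    with insert.prems(2) show ?thesis by (metis diff_self mult_zero_right)
  qed
  then have "c j * (x j - x a) = 0" if "j \<in> I" for j
    using insert.IH[of "\<lambda>j. c j * (x j - x a)" j] insert.prems(1) that by simp
  then have I: "c j = 0" if "j \<in> I" for j
    using that insert.prems(1) insert.hyps \<open>\<And>j. j \<in> I \<Longrightarrow> c j * (x j - x a) = 0\<close>[OF that]
    by (auto simp: inj_on_def)
  moreover have "c a = 0" using insert.prems(2)[of 0] insert.hyps I by simp
  ultimately show ?case using insert.prems(3) by auto
qed simp


section \<open>Permutations whose peaks are the largest values\<close>

lemma card_CP:
  assumes "k < n"
  shows "real (cp n {n - k + 1..n}) = fact k / 2 ^ Suc k *
           (\<Sum>i\<le>Suc k. (-1) ^ i * real (Suc k choose i) * (2 * real (Suc k - i)) ^ (n - k))"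
proof -
  have "cp n {n - k + 1..n} = card (peak_words {1..n - k} {n - k + 1..n})"
    unfolding cp_def by (rule bij_betw_same_card[OF bij_betw_CP_peak_words[OF assms]])
  then show ?thesis
    using card_peak_words[of "{1..n - k}" "{n - k + 1..n}" k] assms by (simp del: sum.atMost_Suc)
qed

text \<open>This makes the assumed formula available at every n = 2k + m with m at least 1.\<close>

lemma CP_nonempty:
  assumes "2 * k < n"
  shows "CP n {n - k + 1..n} \<noteq> {}"
proof -
  have "peak_words {1..n - k} {n - k + 1..n} \<noteq> {}"
    using assms by (intro peak_words_nonempty) auto
  with bij_betw_CP_peak_words[of k n] assms show ?thesis
    by (auto simp: bij_betw_def)
qed

section \<open>Comparison of coefficients\<close>

text \<open>Both sides combine powers of the nodes 2k + 2 - 2i. On the right, the node with i = 0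
  collects the whole alternating sum, and the node with i at least 1 carries only
  \<open>b i\<close>.\<close>

lemma coefficients_of_formula:
  fixes b :: "nat \<Rightarrow> real"
  assumes eq: "\<And>m. m \<ge> 1 \<Longrightarrow>
    fact k / 2 ^ Suc k * (\<Sum>i\<le>Suc k. (-1) ^ i * real (Suc k choose i) * (2 * real (Suc k - i)) ^ (k + m)) =
    real k * (real k + 1) * (\<Sum>i = 1..k. (-1) ^ (i + 1) * b i *
      ((2 * real k + 2) ^ m - (2 * real k + 2 - 2 * real i) ^ m))"
  shows "real k * (real k + 1) * (\<Sum>i = 1..k. (-1) ^ (i + 1) * b i) = fact k * (real k + 1) ^ k / 2"
    and "i \<in> {1..k} \<Longrightarrow> real k * (real k + 1) * b i =
           fact k * real (Suc k choose i) * (real k + 1 - real i) ^ k / 2"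
proof -
  define x where "x i = 2 * real (Suc k - i)" for i
  define S where "S = (\<Sum>i = 1..k. (-1) ^ (i + 1) * b i)"
  define K where "K = real k * (real k + 1)"
  define e where "e i = fact k / 2 ^ Suc k * ((-1) ^ i * real (Suc k choose i)) * x i ^ k" for i
  \<comment> \<open>\<open>d i\<close> is the difference of the two coefficients at the node
    \<open>x i\<close>; in \<open>e i\<close> the fixed factor \<open>x i ^ k\<close> has been moved
    into the coefficient.\<close>
  define d where "d i = e i - K * (if i = 0 then S else (-1) ^ i * b i)" for i
  have split: "(\<Sum>i\<le>k. f i) = f 0 + (\<Sum>i = 1..k. f i)" for f :: "nat \<Rightarrow> real"
    by (simp add: sum.atLeast_Suc_atMost flip: atLeast0AtMost)
  have zero: "(\<Sum>i\<le>k. d i * x i ^ m) = 0" if "m \<ge> 1" for m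
  proof -
    have "K * (S * x 0 ^ m - (\<Sum>i = 1..k. (-1) ^ (i + 1) * b i * x i ^ m)) =
        K * (\<Sum>i = 1..k. (-1) ^ (i + 1) * b i * ((2 * real k + 2) ^ m - (2 * real k + 2 - 2 * real i) ^ m))"
      unfolding S_def sum_distrib_right sum_subtractf[symmetric]
      by (intro arg_cong2[of _ _ _ _ "(*)"] sum.cong refl) (auto simp: x_def algebra_simps)
    also have "\<dots> = (\<Sum>i\<le>Suc k. e i * x i ^ m)"
      unfolding K_def eq[OF that, symmetric] unfolding sum_distrib_left
      by (intro sum.cong refl) (simp add: e_def x_def power_add)
    \<comment> \<open>The node with index \<open>Suc k\<close> is 0, so its term vanishes for
      \<open>m \<ge> 1\<close>.\<close>
    also have "\<dots> = (\<Sum>i\<le>k. e i * x i ^ m)"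
      using that by (simp add: x_def)
    finally show ?thesis
      by (simp add: d_def split algebra_simps sum.distrib sum_subtractf sum_negf sum_distrib_left)
  qed
  have d: "d i = 0" if "i \<le> k" for i
  proof -
    \<comment> \<open>The relation is known only from \<open>m = 1\<close> on, so one factor
      \<open>x i\<close> joins the coefficient; it is nonzero for \<open>i \<le> k\<close>.\<close>
    have "d i * x i = 0"
    proof (rule power_combination_zero[where I = "{..k}" and x = x])
      show "inj_on x {..k}" by (auto simp: inj_on_def x_def)
      show "(\<Sum>i\<le>k. d i * x i * x i ^ m) = 0" for m
        using zero[of "Suc m"] by (simp add: mult_ac)
    qed (use that in auto)
    with that show ?thesis by (simp add: x_def)
  qed
  have "fact k / 2 ^ Suc k * (2 * t) ^ k = fact k * t ^ k / 2" for t :: real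
    by (simp add: power_mult_distrib)
  note e = this[of "real (Suc k - i)" for i]
  show "real k * (real k + 1) * (\<Sum>i = 1..k. (-1) ^ (i + 1) * b i) = fact k * (real k + 1) ^ k / 2"
    using d[of 0] e[of 0] unfolding d_def e_def x_def K_def S_def by (simp add: add_ac)
  show "real k * (real k + 1) * b i =
           fact k * real (Suc k choose i) * (real k + 1 - real i) ^ k / 2" if "i \<in> {1..k}"
  proof -
    have "(-1) ^ i * (K * b i) = e i"
      using d[of i] that unfolding d_def by simp
    also have "e i = (-1) ^ i * (real (Suc k choose i) * (fact k / 2 ^ Suc k * x i ^ k))"
      by (simp add: e_def)
    finally have "K * b i = real (Suc k choose i) * (fact k / 2 ^ Suc k * x i ^ k)"
      by (simp only: mult_cancel_left) simp
    also have "real (Suc k - i) = real k + 1 - real i" using that by simp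
    then have "fact k / 2 ^ Suc k * x i ^ k = fact k * (real k + 1 - real i) ^ k / 2"
      using e[of i] by (simp only: x_def)
    finally show ?thesis by (simp add: K_def)
  qed
qed

section \<open>The recursion\<close>

theorem theorem3p1:
  fixes b :: "nat \<Rightarrow> nat \<Rightarrow> real"
  assumes formula: "\<And>k n :: nat. k \<ge> 1 \<Longrightarrow> n \<ge> max 3 (2 * k) \<Longrightarrow> CP n {n - k + 1..n} \<noteq> {} \<Longrightarrow>
    real (cp n {n - k + 1..n}) =
      real k * (real k + 1) *
        (\<Sum>i = 1..k. (-1) ^ (i + 1) * b k i *
          ((2 * real k + 2) ^ (n - 2 * k) - (2 * real k + 2 - 2 * real i) ^ (n - 2 * k)))"
  shows "\<forall>k \<ge> 1. \<forall>i \<in> {1..k + 1}.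
    b (k + 1) i =
      (if i = 1 then real k * (real k + 1)\<^sup>2 * (\<Sum>j = 1..k. (-1) ^ (j + 1) * b k j)
       else real k * (real k + 1) * ((real k + 2 - real i) / real i) * b k (i - 1))"
proof (intro allI impI ballI)
  fix k i :: nat
  assume k: "1 \<le> k" and i: "i \<in> {1..k + 1}"
  \<comment> \<open>Here n = 2k + m, so n is at least 3 and n - k = k + m.\<close>
  have eq: "fact k / 2 ^ Suc k * (\<Sum>i\<le>Suc k. (-1) ^ i * real (Suc k choose i) * (2 * real (Suc k - i)) ^ (k + m)) =
      real k * (real k + 1) * (\<Sum>i = 1..k. (-1) ^ (i + 1) * b k i *
        ((2 * real k + 2) ^ m - (2 * real k + 2 - 2 * real i) ^ m))" if "k \<ge> 1" "m \<ge> 1" for k m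
  proof -
    have n: "2 * k + m - 2 * k = m" "2 * k + m - k = k + m" by auto
    show ?thesis
      by (rule trans[OF card_CP[of k "2 * k + m", unfolded n, symmetric] formula[of k "2 * k + m", unfolded n]])
        (use that CP_nonempty[of k "2 * k + m"] in auto)
  qed
  have sum_k: "real k * (real k + 1) * (\<Sum>j = 1..k. (-1) ^ (j + 1) * b k j) = fact k * (real k + 1) ^ k / 2"
    by (rule coefficients_of_formula(1)[OF eq[OF k]])
  have b_k: "real k * (real k + 1) * b k j = fact k * real (Suc k choose j) * (real k + 1 - real j) ^ k / 2"
    if "j \<in> {1..k}" for j
    by (rule coefficients_of_formula(2)[OF eq[OF k] that])
  have "(real k + 1) * (real k + 2) * b (k + 1) i =
      fact (k + 1) * real (Suc (k + 1) choose i) * (real k + 2 - real i) ^ (k + 1) / 2"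
    using coefficients_of_formula(2)[OF eq[of "k + 1"] i] by (simp add: algebra_simps)
  moreover have "fact (k + 1) = (real k + 1) * fact k" by simp
  moreover have "real k + 1 \<noteq> 0" by simp
  ultimately have b_Suc: "(real k + 2) * b (k + 1) i =
      fact k * real (Suc (k + 1) choose i) * (real k + 2 - real i) ^ (k + 1) / 2"
    by (simp only: mult.assoc mult_cancel_left times_divide_eq_right[symmetric] simp_thms)
  show "b (k + 1) i =
      (if i = 1 then real k * (real k + 1)\<^sup>2 * (\<Sum>j = 1..k. (-1) ^ (j + 1) * b k j)
       else real k * (real k + 1) * ((real k + 2 - real i) / real i) * b k (i - 1))"
  proof (cases "i = 1")
    case True
    \<comment> \<open>For \<open>i = 1\<close> the binomial coefficient is k + 2 and cancels; the
      remaining power splits as (k + 1) times the one in \<open>sum_k\<close>.\<close>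
    have "(real k + 2) * b (k + 1) i = (real k + 2) * ((real k + 1) * (fact k * (real k + 1) ^ k / 2))"
      using b_Suc True by (simp add: algebra_simps)
    then have "b (k + 1) i = (real k + 1) * (fact k * (real k + 1) ^ k / 2)"
      by simp
    with True show ?thesis
      unfolding sum_k[symmetric] by (simp add: power2_eq_square)
  next
    case False
    then obtain j where j: "i = Suc j" "j \<in> {1..k}" using i by (cases i) auto
    \<comment> \<open>Absorption lowers both binomial indices by one, which is where the division by
      \<open>i\<close> in the recursion comes from.\<close>
    have absorb: "real i * real (Suc (k + 1) choose i) = (real k + 2) * real (Suc k choose j)"
      using Suc_times_binomial_eq[of "Suc k" j] unfolding j(1) by (metis Suc_eq_plus1 add_2_eq_Suc' mult.commute of_nat_Suc of_nat_add of_nat_mult of_nat_numeral)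
    have "(real k + 2) * (real i * b (k + 1) i) = real i * ((real k + 2) * b (k + 1) i)"
      by (simp only: mult_ac)
    also have "\<dots> = (real i * real (Suc (k + 1) choose i)) * (fact k * (real k + 2 - real i) ^ (k + 1) / 2)"
      unfolding b_Suc by (simp only: mult_ac times_divide_eq_right)
    also have "\<dots> = (real k + 2) *
        ((real k + 2 - real i) * (fact k * real (Suc k choose j) * (real k + 1 - real j) ^ k / 2))"
    proof -
      have "real k + 1 - real j = real k + 2 - real i" using j(1) by simp
      then show ?thesis
        unfolding absorb by (simp only: power_Suc Suc_eq_plus1[symmetric] mult_ac times_divide_eq_right)
    qed
    finally have "(real k + 2) * (real i * b (k + 1) i) = (real k + 2) *
        ((real k + 2 - real i) * (fact k * real (Suc k choose j) * (real k + 1 - real j) ^ k / 2))" .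
    then have "real i * b (k + 1) i = (real k + 2 - real i) * (real k * (real k + 1) * b k j)"
      unfolding b_k[OF j(2)] by simp
    then have "b (k + 1) i = (real k + 2 - real i) * (real k * (real k + 1) * b k j) / real i"
      using i by (simp add: field_simps)
    with False j(1) show ?thesis by simp
  qed
qed

end
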